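(* Let $T>0$, $\sigma\in\mathbb{R}$, $0<R\le 1$, and $\alpha(r)=\lambda e^{-\rho r}+(1-\lambda)e^{-\gamma r}$ with $\gamma>\rho>0$ and $\lambda\in(0,1)$. Then the equilibrium Riccati equation $$\left\{\begin{aligned} & P_s(t,s)+2P(t,s)\big[\bar\Theta_1(s)+\bar\Theta_2(s)\big]+\sigma^2P(t,s)+\alpha(s-t)\big[-\bar\Theta_1(s)^2+R\,\bar\Theta_2(s)^2\big]=0,\quad (t,s)\in\Delta[0,T],\\ & P(t,T)=\alpha(T-t),\quad t\in[0,T], \end{aligned}\right.$$ where $$\bar\Theta_1(s)=P(s,s),\qquad \bar\Theta_2(s)=-\frac{P(s,s)}{R},\qquad s\in[0,T],$$ admits a unique solution $P(\cdot,\cdot)\in C(\Delta[0,T])$. Moreover, $P(t,s)\ge 0$ for all $(t,s)\in\Delta[0,T]$. In particular, if $R=1$, the unique solution is given explicitly by $$P(t,s)=e^{-\sigma^2(s-T)}\alpha(T-t),\qquad (t,s)\in\Delta[0,T].$$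
   Context: $\Delta[0,T]=\{(t,s)\in[0,T]^2 : 0\le t\le s\le T\}$, and $C(\Delta[0,T])$ is the space of continuous real-valued functions on it. $P_s$ denotes the partial derivative with respect to the second variable $s$. The equation is non-local because the diagonal values $P(s,s)$ enter the equation for $P(t,s)$. *)

theory Defs
  imports "HOL-Analysis.Analysis"
begin

definition discount :: "real \<Rightarrow> real \<Rightarrow> real \<Rightarrow> real \<Rightarrow> real" where
  "discount lam \<rho> \<gamma> r = lam * exp (- \<rho> * r) + (1 - lam) * exp (- \<gamma> * r)"

definition Delta :: "real \<Rightarrow> (real \<times> real) set" where
  "Delta T = {(t, s). 0 \<le> t \<and> t \<le> s \<and> s \<le> T}"

definition Theta1 :: "(real \<Rightarrow> real \<Rightarrow> real) \<Rightarrow> real \<Rightarrow> real" where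
  "Theta1 P s = P s s"

definition Theta2 :: "real \<Rightarrow> (real \<Rightarrow> real \<Rightarrow> real) \<Rightarrow> real \<Rightarrow> real" where
  "Theta2 R P s = - P s s / R"

text \<open>
  The unknown is defined on the triangle \<open>Delta T\<close> only; it is represented by a total function whose
  values off the triangle are irrelevant. Accordingly the derivative in \<open>s\<close> is taken within the section
  \<open>{t..T}\<close> of the triangle, i.e. it is one-sided at \<open>s = t\<close> and \<open>s = T\<close>. For \<open>t = T\<close> the section is a
  single point, every number is a derivative there, and the differential equation is void.
\<close>

definition riccati_solution ::
    "real \<Rightarrow> real \<Rightarrow> real \<Rightarrow> (real \<Rightarrow> real) \<Rightarrow> (real \<Rightarrow> real \<Rightarrow> real) \<Rightarrow> bool" where
  "riccati_solution T \<sigma> R \<alpha> P \<longleftrightarrow>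
     continuous_on (Delta T) (\<lambda>(t, s). P t s) \<and>
     (\<forall>(t, s) \<in> Delta T. \<exists>Ps. (P t has_real_derivative Ps) (at s within {t..T}) \<and>
        Ps + 2 * P t s * (Theta1 P s + Theta2 R P s) + \<sigma>\<^sup>2 * P t s
           + \<alpha> (s - t) * (- (Theta1 P s)\<^sup>2 + R * (Theta2 R P s)\<^sup>2) = 0) \<and>
     (\<forall>t \<in> {0..T}. P t T = \<alpha> (T - t))"

end

theory Submission imports Defs begin

text \<open>
  With \<open>\<kappa> = 1/R - 1 \<ge> 0\<close> and \<open>p(s) = P(s,s)\<close> the equation reads
  \<open>P\<^sub>s = (2\<kappa>p(s) - \<sigma>\<^sup>2) P - \<kappa> \<alpha>(s-t) p(s)\<^sup>2\<close>. Since \<open>\<alpha>\<close> is a sum of two exponentials, the ansatz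
  \<open>P(t,s) = \<lambda> e\<^bsup>-\<rho>(s-t)\<^esup> a(T-s) + (1-\<lambda>) e\<^bsup>-\<gamma>(s-t)\<^esup> b(T-s)\<close> reduces it to a planar quadratic system
  for \<open>(a,b)\<close> with \<open>p = \<lambda>a + (1-\<lambda>)b\<close> and \<open>a(0) = b(0) = 1\<close>. There \<open>a, b \<ge> 0\<close> and \<open>p' \<le> \<sigma>\<^sup>2 p\<close>, so
  solutions cannot blow up. The difference \<open>D\<close> of two solutions satisfies
  \<open>|D\<^sub>s(t,s)| \<le> K (|D(t,s)| + |D(s,s)|)\<close>, which forces \<open>D = 0\<close> in the sup norm with weight \<open>e\<^bsup>-4K(T-s)\<^esup>\<close>.
\<close>

section \<open>Monotonicity and sign from derivatives within an interval\<close>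

lemma has_real_derivative_nonpos_antimono:
  fixes f f' :: "real \<Rightarrow> real"
  assumes "a \<le> b"
    and der: "\<And>x. x \<in> {a..b} \<Longrightarrow> (f has_real_derivative f' x) (at x within {a..b})"
    and nonpos: "\<And>x. a < x \<Longrightarrow> x < b \<Longrightarrow> f' x \<le> 0"
  shows "f b \<le> f a"
proof (rule DERIV_nonpos_imp_decreasing_open[OF \<open>a \<le> b\<close>])
  show "\<exists>y. DERIV f x :> y \<and> y \<le> 0" if "a < x" "x < b" for x
    using der[of x] nonpos[OF that] that at_within_Icc_at[OF that] by auto
  show "continuous_on {a..b} f"
    using der by (meson DERIV_continuous continuous_on_eq_continuous_within)
qed

text \<open>After the last time \<open>s\<close> in \<open>{a..t}\<close> with
  \<open>0 \<le> f s\<close> the function is negative, hence nondecreasing, so \<open>f t\<close>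
  cannot fall below \<open>f s\<close>. That last time exists because the set of such times is
  compact and contains \<open>a\<close>.\<close>

lemma nonneg_if_increasing_below_zero:
  fixes f f' :: "real \<Rightarrow> real"
  assumes der: "\<And>x. x \<in> {a..b} \<Longrightarrow> (f has_real_derivative f' x) (at x within {a..b})"
    and "0 \<le> f a"
    and below: "\<And>x. x \<in> {a..b} \<Longrightarrow> f x < 0 \<Longrightarrow> 0 \<le> f' x"
    and t: "t \<in> {a..b}"
  shows "0 \<le> f t"
proof -
  have "continuous_on {a..b} f"
    using der by (meson DERIV_continuous continuous_on_eq_continuous_within)
  then have cont: "continuous_on {a..t} f"
    by (rule continuous_on_subset) (use t in auto)
  define S where "S = {x \<in> {a..t}. 0 \<le> f x}"
  have "closed ({a..t} \<inter> f -` {0..})"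
    by (intro continuous_closed_preimage cont closed_atLeastAtMost closed_atLeast)
  then have "compact ({a..t} \<inter> ({a..t} \<inter> f -` {0..}))"
    by (intro compact_Int_closed compact_Icc)
  also have "{a..t} \<inter> ({a..t} \<inter> f -` {0..}) = S" by (auto simp: S_def)
  finally have "compact S" .
  moreover have "a \<in> S" using t \<open>0 \<le> f a\<close> by (auto simp: S_def)
  ultimately obtain s where s: "s \<in> S" and max: "\<And>x. x \<in> S \<Longrightarrow> x \<le> s"
    using compact_attains_sup[of S] by blast
  have "- f t \<le> - f s"
  proof (rule has_real_derivative_nonpos_antimono[where f = "\<lambda>x. - f x"])
    show "s \<le> t" using s by (auto simp: S_def)
    show "((\<lambda>x. - f x) has_real_derivative - f' x) (at x within {s..t})" if "x \<in> {s..t}" for x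
      using der[of x] that s t by (auto intro!: DERIV_minus intro: DERIV_subset simp: S_def)
    show "- f' x \<le> 0" if "s < x" "x < t" for x
    proof -
      have "f x < 0" using max[of x] that s by (force simp: S_def)
      then show ?thesis using below[of x] that s t by (auto simp: S_def)
    qed
  qed
  then show ?thesis using s by (auto simp: S_def)
qed

section \<open>Global Picard-Lindelof theorem for Lipschitz autonomous fields\<close>

text \<open>
  The fixed point \<open>y\<close> is the solution scaled by \<open>e\<^bsup>-Lt\<^esup>\<close>, which makes the Picard map a contraction on
  the whole interval; clipping time to \<open>{0..T}\<close> turns \<open>y\<close> into a bounded continuous function on \<open>\<real>\<close>.
\<close>

lemma picard_integral_equation:
  fixes f :: "'a::banach \<Rightarrow> 'a" and T :: real
  assumes "0 \<le> T" and f: "K-lipschitz_on UNIV f"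
  obtains x where "continuous_on {0..T} x"
    and "\<And>t. t \<in> {0..T} \<Longrightarrow> x t = x0 + integral {0..t} (\<lambda>r. f (x r))"
proof -
  have K: "0 \<le> K" using f by (rule lipschitz_on_nonneg)
  \<comment> \<open>Any \<open>L > K\<close> makes the factor \<open>K / L\<close> less than 1; the
    summand 1 keeps \<open>L\<close> positive when \<open>K = 0\<close>.\<close>
  define L where "L = 2 * K + 1"
  have L: "0 < L" using K by (simp add: L_def)
  define clip where "clip t = max 0 (min T t)" for t
  have clip: "clip t \<in> {0..T}" for t using \<open>0 \<le> T\<close> by (simp add: clip_def)
  have f_cont: "continuous_on S f" for S
    using lipschitz_on_continuous_on[OF f] continuous_on_subset by blast
  define g where "g y r = f (exp (L * r) *\<^sub>R apply_bcontfun y r)" for y :: "real \<Rightarrow>\<^sub>C 'a" and r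
  have g_cont: "continuous_on S (g y)" for S y
    unfolding g_def by (rule continuous_on_compose2[OF f_cont[of UNIV]]) (auto intro!: continuous_intros)
  have g_int: "g y integrable_on {a..b}" for y a b
    by (rule integrable_continuous_real[OF g_cont])
  define I where "I y t = exp (- L * t) *\<^sub>R (x0 + integral {0..t} (g y))" for y t
  have I_cont: "continuous_on {0..T} (I y)" for y
    unfolding I_def by (intro continuous_intros indefinite_integral_continuous_1 g_int)
  define \<Phi> where "\<Phi> y = Bcontfun (\<lambda>t. I y (clip t))" for y
  \<comment> \<open>\<open>Bcontfun\<close> is meaningful only on bounded continuous functions:
    continuity comes from \<open>clip\<close>, boundedness from compactness of
    \<open>{0..T}\<close>.\<close>
  have \<Phi>: "apply_bcontfun (\<Phi> y) t = I y (clip t)" for y t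
  proof -
    have "continuous_on UNIV (\<lambda>t. I y (clip t))"
      by (rule continuous_on_compose2[OF I_cont]) (use clip in \<open>auto simp: clip_def intro!: continuous_intros\<close>)
    moreover have "bounded (I y ` {0..T})"
      by (intro compact_imp_bounded compact_continuous_image I_cont compact_Icc)
    then have "bounded (range (\<lambda>t. I y (clip t)))"
      by (rule bounded_subset) (use clip in auto)
    ultimately show ?thesis
      unfolding \<Phi>_def by (subst Bcontfun_inverse) (auto simp: bcontfun_def)
  qed
  \<comment> \<open>Unscaling turns the distance of \<open>y\<close> and \<open>z\<close> at time
    \<open>r\<close> into at most \<open>exp (L * r) * dist y z\<close>. Integrating
    \<open>K\<close> times this up to \<open>s\<close> costs at most
    \<open>K / L * exp (L * s)\<close>, and the outer weight \<open>exp (- L * s)\<close> cancels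
    the exponential.\<close>
  have contr: "dist (\<Phi> y) (\<Phi> z) \<le> K / L * dist y z" for y z
  proof (rule dist_bound)
    fix t
    define s where "s = clip t"
    have s: "0 \<le> s" using clip[of t] by (simp add: s_def)
    have hi: "((\<lambda>r. K * dist y z * exp (L * r)) has_integral
        (K * dist y z / L * exp (L * s) - K * dist y z / L * exp (L * 0))) {0..s}"
      by (rule fundamental_theorem_of_calculus[OF s])
        (use L in \<open>auto intro!: derivative_eq_intros simp flip: has_real_derivative_iff_has_vector_derivative\<close>)
    have "norm (integral {0..s} (\<lambda>r. g y r - g z r)) \<le> integral {0..s} (\<lambda>r. K * dist y z * exp (L * r))"
    proof (rule integral_norm_bound_integral)
      show "norm (g y r - g z r) \<le> K * dist y z * exp (L * r)" for r
      proof -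
        have "norm (g y r - g z r) \<le> K * dist (exp (L * r) *\<^sub>R apply_bcontfun y r) (exp (L * r) *\<^sub>R apply_bcontfun z r)"
          unfolding g_def dist_norm[symmetric] by (rule lipschitz_onD[OF f]) auto
        also have "\<dots> = K * (exp (L * r) * dist (apply_bcontfun y r) (apply_bcontfun z r))"
          by (simp add: dist_norm flip: scaleR_diff_right)
        also have "\<dots> \<le> K * (exp (L * r) * dist y z)"
          using K by (intro mult_left_mono dist_bounded) auto
        finally show ?thesis by (simp add: ac_simps)
      qed
    qed (use hi in \<open>auto intro!: integrable_diff g_int\<close>)
    also have "\<dots> \<le> K * dist y z / L * exp (L * s)"
      using hi K L by (subst integral_unique[OF hi]) auto
    finally have bd: "norm (integral {0..s} (\<lambda>r. g y r - g z r)) \<le> K * dist y z / L * exp (L * s)" .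
    have "I y s - I z s = exp (- L * s) *\<^sub>R integral {0..s} (\<lambda>r. g y r - g z r)"
      by (simp add: I_def integral_diff g_int scaleR_diff_right[symmetric])
    then have "dist (I y s) (I z s) \<le> exp (- L * s) * (K * dist y z / L * exp (L * s))"
      using mult_left_mono[OF bd, of "exp (- L * s)"] by (simp add: dist_norm[of "I y s"])
    also have "\<dots> = K / L * dist y z" by (simp add: exp_minus)
    finally show "dist (apply_bcontfun (\<Phi> y) t) (apply_bcontfun (\<Phi> z) t) \<le> K / L * dist y z"
      by (simp add: \<Phi> s_def)
  qed
  have "0 \<le> K / L" "K / L < 1" using K by (auto simp: L_def)
  with contr obtain y where y: "\<Phi> y = y"
    using banach_fix_type[of "K / L" \<Phi>] by blast
  \<comment> \<open>Undoing the scaling turns the fixed point equation into the integral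
    equation.\<close>
  define x where "x t = exp (L * t) *\<^sub>R apply_bcontfun y t" for t
  show thesis
  proof
    show "continuous_on {0..T} x" unfolding x_def by (intro continuous_intros) auto
    show "x t = x0 + integral {0..t} (\<lambda>r. f (x r))" if "t \<in> {0..T}" for t
    proof -
      have "clip t = t" using that by (auto simp: clip_def)
      then have "apply_bcontfun y t = I y t" using \<Phi>[of y t] y by simp
      then show ?thesis by (simp add: x_def I_def g_def[abs_def] exp_minus)
    qed
  qed
qed

lemma picard_global:
  fixes f :: "'a::banach \<Rightarrow> 'a" and T :: real
  assumes "0 \<le> T" and f: "K-lipschitz_on UNIV f"
  obtains x where "x 0 = x0"
    and "\<And>t. t \<in> {0..T} \<Longrightarrow> (x has_vector_derivative f (x t)) (at t within {0..T})"
proof -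
  obtain x where x_cont: "continuous_on {0..T} x"
    and x: "\<And>t. t \<in> {0..T} \<Longrightarrow> x t = x0 + integral {0..t} (\<lambda>r. f (x r))"
    by (rule picard_integral_equation[OF assms, of x0]) blast
  have "continuous_on {0..T} (\<lambda>r. f (x r))"
    by (rule continuous_on_compose2[OF lipschitz_on_continuous_on[OF f] x_cont]) auto
  then have dx: "((\<lambda>u. x0 + integral {0..u} (\<lambda>r. f (x r))) has_vector_derivative f (x t)) (at t within {0..T})"
    if "t \<in> {0..T}" for t
    using that by (auto intro!: derivative_eq_intros integral_has_vector_derivative)
  have "(x has_vector_derivative f (x t)) (at t within {0..T})" if "t \<in> {0..T}" for t
    by (rule has_vector_derivative_transform[OF that x dx[OF that]])
  moreover have "x 0 = x0" using x[of 0] \<open>0 \<le> T\<close> by simp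
  ultimately show thesis using that by blast
qed

section \<open>Lipschitz estimates for products and truncations\<close>

text \<open>Products of unbounded Lipschitz functions need not be Lipschitz. The sup bounds repair
  this; for the quadratic terms of the planar system they come from truncation.\<close>

lemma lipschitz_on_mult_bounded:
  fixes f g :: "'a::metric_space \<Rightarrow> real"
  assumes f: "K-lipschitz_on S f" and g: "L-lipschitz_on S g"
    and A: "\<And>x. x \<in> S \<Longrightarrow> \<bar>f x\<bar> \<le> A" and B: "\<And>x. x \<in> S \<Longrightarrow> \<bar>g x\<bar> \<le> B"
    and "0 \<le> A" "0 \<le> B"
  shows "(A * L + B * K)-lipschitz_on S (\<lambda>x. f x * g x)"
proof (rule lipschitz_onI)
  fix x y assume xy: "x \<in> S" "y \<in> S"
  have "f x * g x - f y * g y = f x * (g x - g y) + g y * (f x - f y)" by (simp add: algebra_simps)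
  then have "dist (f x * g x) (f y * g y) \<le> \<bar>f x\<bar> * dist (g x) (g y) + \<bar>g y\<bar> * dist (f x) (f y)"
    by (simp add: dist_real_def abs_mult[symmetric])
  also have "\<dots> \<le> A * (L * dist x y) + B * (K * dist x y)"
    using xy A B assms(5,6) by (intro add_mono mult_mono lipschitz_onD[OF f] lipschitz_onD[OF g]) auto
  finally show "dist (f x * g x) (f y * g y) \<le> (A * L + B * K) * dist x y" by (simp add: algebra_simps)
next
  show "0 \<le> A * L + B * K"
    using assms(5,6) lipschitz_on_nonneg[OF f] lipschitz_on_nonneg[OF g] by simp
qed

lemma lipschitz_on_clip:
  fixes f :: "'a::metric_space \<Rightarrow> real"
  assumes "K-lipschitz_on S f"
  shows "K-lipschitz_on S (\<lambda>x. max 0 (min M (f x)))"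
proof (rule lipschitz_onI)
  show "dist (max 0 (min M (f x))) (max 0 (min M (f y))) \<le> K * dist x y" if "x \<in> S" "y \<in> S" for x y
    using lipschitz_onD[OF assms that] by (auto simp: dist_real_def)
qed (rule lipschitz_on_nonneg[OF assms])

section \<open>Normal form of the equation and uniqueness\<close>

text \<open>With \<open>p = P s s\<close> and \<open>k = 1 / R - 1\<close>, the sum of the two
  Thetas is \<open>- k * p\<close>, and the bracket multiplying \<open>\<alpha> (s - t)\<close> is
  \<open>k * p^2\<close>. The equation is then solved for \<open>Ps\<close>, so the existential goes
  away by substitution, also at \<open>t = T\<close>, where derivatives are not unique.\<close>

lemma riccati_solution_iff:
  assumes "R \<noteq> 0"
  shows "riccati_solution T \<sigma> R \<alpha> P \<longleftrightarrow>
     continuous_on (Delta T) (\<lambda>(t, s). P t s) \<and>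
     (\<forall>(t, s) \<in> Delta T. (P t has_real_derivative
        (2 * (1 / R - 1) * P s s - \<sigma>\<^sup>2) * P t s - (1 / R - 1) * \<alpha> (s - t) * (P s s)\<^sup>2) (at s within {t..T})) \<and>
     (\<forall>t \<in> {0..T}. P t T = \<alpha> (T - t))"
proof -
  have "Ps + 2 * P t s * (Theta1 P s + Theta2 R P s) + \<sigma>\<^sup>2 * P t s
           + \<alpha> (s - t) * (- (Theta1 P s)\<^sup>2 + R * (Theta2 R P s)\<^sup>2) = 0 \<longleftrightarrow>
        Ps = (2 * (1 / R - 1) * P s s - \<sigma>\<^sup>2) * P t s - (1 / R - 1) * \<alpha> (s - t) * (P s s)\<^sup>2" for Ps t s
  proof -
    have "2 * P t s * (Theta1 P s + Theta2 R P s) + \<sigma>\<^sup>2 * P t s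
           + \<alpha> (s - t) * (- (Theta1 P s)\<^sup>2 + R * (Theta2 R P s)\<^sup>2) =
       - ((2 * (1 / R - 1) * P s s - \<sigma>\<^sup>2) * P t s - (1 / R - 1) * \<alpha> (s - t) * (P s s)\<^sup>2)"
      using assms by (simp add: Theta1_def Theta2_def field_simps power2_eq_square)
    then show ?thesis by linarith
  qed
  then show ?thesis unfolding riccati_solution_def by simp
qed

lemma compact_Delta: "compact (Delta T)"
proof -
  have "Delta T = {x \<in> {0..T} \<times> {0..T}. fst x \<le> snd x}" by (auto simp: Delta_def)
  also have "\<dots> = ({0..T} \<times> {0..T}) \<inter> {x. fst x \<le> snd x}" by auto
  also have "compact \<dots>"
    by (intro compact_Int_closed compact_Times compact_Icc closed_Collect_le continuous_intros)
  finally show ?thesis .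
qed

lemma bounded_on_Delta:
  assumes "continuous_on (Delta T) (\<lambda>(t, s). P t s :: real)"
  obtains B where "0 \<le> B" "\<And>t s. (t, s) \<in> Delta T \<Longrightarrow> \<bar>P t s\<bar> \<le> B"
proof -
  obtain B where "B > 0" "\<And>y. y \<in> (\<lambda>(t, s). P t s) ` Delta T \<Longrightarrow> norm y \<le> B"
    using compact_imp_bounded[OF compact_continuous_image[OF assms compact_Delta]] bounded_pos by metis
  then show thesis by (intro that[of B]) force+
qed

text \<open>The weighted supremum \<open>N\<close> of the difference is attained on the compact
  triangle. Integrating backwards from the zero terminal value along the section through the maximum
  point gives \<open>N \<le> N / 2\<close>.\<close>

lemma riccati_solution_unique:
  assumes "0 \<le> T" "R \<noteq> 0" and \<alpha>: "continuous_on {0..T} \<alpha>"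
    and P: "riccati_solution T \<sigma> R \<alpha> P" and Q: "riccati_solution T \<sigma> R \<alpha> Q"
    and ts: "(t, s) \<in> Delta T"
  shows "P t s = Q t s"
proof -
  define \<kappa> where "\<kappa> = 1 / R - 1"
  note P' = P[unfolded riccati_solution_iff[OF \<open>R \<noteq> 0\<close>], folded \<kappa>_def]
  note Q' = Q[unfolded riccati_solution_iff[OF \<open>R \<noteq> 0\<close>], folded \<kappa>_def]
  obtain B1 where B1: "0 \<le> B1" "\<And>t s. (t, s) \<in> Delta T \<Longrightarrow> \<bar>P t s\<bar> \<le> B1"
    using bounded_on_Delta P' by blast
  obtain B2 where B2: "0 \<le> B2" "\<And>t s. (t, s) \<in> Delta T \<Longrightarrow> \<bar>Q t s\<bar> \<le> B2"
    using bounded_on_Delta Q' by blast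
  obtain A where A: "0 < A" "\<And>r. r \<in> {0..T} \<Longrightarrow> \<bar>\<alpha> r\<bar> \<le> A"
    using compact_imp_bounded[OF compact_continuous_image[OF \<alpha> compact_Icc]]
    unfolding bounded_pos by auto
  define D where "D t s = P t s - Q t s" for t s
  \<comment> \<open>Both quadratic differences factor:
    \<open>p * P - q * Q = p * D + Q * (p - q)\<close> and
    \<open>p^2 - q^2 = (p + q) * (p - q)\<close>, with \<open>p\<close>, \<open>q\<close> the
    diagonal values. So \<open>D\<close> solves a linear equation in \<open>D t s\<close> and
    \<open>D s s\<close>.\<close>
  define D' where "D' t s = (2 * \<kappa> * P s s - \<sigma>\<^sup>2) * D t s
      + \<kappa> * (2 * Q t s - \<alpha> (s - t) * (P s s + Q s s)) * D s s" for t s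
  have der: "(D t has_real_derivative D' t s) (at s within {t..T})" if "(t, s) \<in> Delta T" for t s
  proof -
    have "((\<lambda>s. P t s - Q t s) has_real_derivative
        ((2 * \<kappa> * P s s - \<sigma>\<^sup>2) * P t s - \<kappa> * \<alpha> (s - t) * (P s s)\<^sup>2) -
        ((2 * \<kappa> * Q s s - \<sigma>\<^sup>2) * Q t s - \<kappa> * \<alpha> (s - t) * (Q s s)\<^sup>2)) (at s within {t..T})"
      using P' Q' that by (intro DERIV_diff) auto
    then show ?thesis
      unfolding D_def[abs_def] by (rule DERIV_cong) (simp add: D_def D'_def algebra_simps power2_eq_square)
  qed
  \<comment> \<open>The first two summands bound the coefficient of \<open>D t s\<close>, the third
    that of \<open>D s s\<close>; the 1 ensures \<open>K > 0\<close>.\<close>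
  define K where "K = 2 * \<bar>\<kappa>\<bar> * B1 + \<sigma>\<^sup>2 + \<bar>\<kappa>\<bar> * (2 * B2 + A * (B1 + B2)) + 1"
  have K: "0 < K" using B1(1) B2(1) A(1) by (auto simp: K_def intro!: add_nonneg_pos add_nonneg_nonneg)
  have D'_le: "\<bar>D' t s\<bar> \<le> K * (\<bar>D t s\<bar> + \<bar>D s s\<bar>)" if ts: "(t, s) \<in> Delta T" for t s
  proof -
    have ss: "(s, s) \<in> Delta T" and st: "s - t \<in> {0..T}" using ts by (auto simp: Delta_def)
    have "\<bar>2 * \<kappa> * P s s - \<sigma>\<^sup>2\<bar> \<le> \<bar>2 * \<kappa> * P s s\<bar> + \<bar>\<sigma>\<^sup>2\<bar>" by (rule abs_triangle_ineq4)
    also have "\<dots> \<le> 2 * \<bar>\<kappa>\<bar> * B1 + \<sigma>\<^sup>2"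
      using B1(2)[OF ss] by (simp add: abs_mult mult_left_mono)
    also have "\<dots> \<le> K" using B1(1) B2(1) A(1) by (simp add: K_def)
    finally have 1: "\<bar>2 * \<kappa> * P s s - \<sigma>\<^sup>2\<bar> \<le> K" .
    have "\<bar>\<alpha> (s - t) * (P s s + Q s s)\<bar> \<le> A * (B1 + B2)"
      unfolding abs_mult using A(1) A(2)[OF st] B1(2)[OF ss] B2(2)[OF ss] by (intro mult_mono) auto
    then have "\<bar>2 * Q t s - \<alpha> (s - t) * (P s s + Q s s)\<bar> \<le> 2 * B2 + A * (B1 + B2)"
      using B2(2)[OF ts] by linarith
    then have "\<bar>\<kappa> * (2 * Q t s - \<alpha> (s - t) * (P s s + Q s s))\<bar> \<le> \<bar>\<kappa>\<bar> * (2 * B2 + A * (B1 + B2))"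
      unfolding abs_mult by (intro mult_left_mono) auto
    also have "\<dots> \<le> K" using B1(1) B2(1) A(1) by (simp add: K_def)
    finally have 2: "\<bar>\<kappa> * (2 * Q t s - \<alpha> (s - t) * (P s s + Q s s))\<bar> \<le> K" .
    have "\<bar>D' t s\<bar> \<le> \<bar>2 * \<kappa> * P s s - \<sigma>\<^sup>2\<bar> * \<bar>D t s\<bar>
        + \<bar>\<kappa> * (2 * Q t s - \<alpha> (s - t) * (P s s + Q s s))\<bar> * \<bar>D s s\<bar>"
      unfolding D'_def abs_mult[symmetric] by (rule abs_triangle_ineq)
    also have "\<dots> \<le> K * \<bar>D t s\<bar> + K * \<bar>D s s\<bar>"
      by (intro add_mono mult_right_mono 1 2) auto
    finally show ?thesis by (simp add: algebra_simps)
  qed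
  \<comment> \<open>Each of the two terms in \<open>D'_le\<close> is at most
    \<open>K * N * exp (L * (T - s))\<close>; integrating their sum yields the factor
    \<open>2 * K / L = 1 / 2\<close>.\<close>
  define L where "L = 4 * K"
  define W where "W = (\<lambda>(t, s). \<bar>D t s\<bar> * exp (- L * (T - s)))"
  have "continuous_on (Delta T) (\<lambda>(t, s). D t s)"
    using P' Q' unfolding D_def case_prod_unfold by (intro continuous_on_diff) auto
  then have "continuous_on (Delta T) W"
    unfolding W_def case_prod_unfold by (intro continuous_intros)
  moreover have "Delta T \<noteq> {}" using ts by auto
  ultimately obtain t0 s0 where m: "(t0, s0) \<in> Delta T" and max: "\<And>x. x \<in> Delta T \<Longrightarrow> W x \<le> W (t0, s0)"
    using continuous_attains_sup[OF compact_Delta] by (metis surj_pair)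
  define N where "N = W (t0, s0)"
  have N: "0 \<le> N" by (simp add: N_def W_def)
  have D_le: "\<bar>D t s\<bar> \<le> N * exp (L * (T - s))" if "(t, s) \<in> Delta T" for t s
    using max[OF that] unfolding N_def[symmetric] by (simp add: W_def exp_diff right_diff_distrib field_simps)
  \<comment> \<open>Stated for a general \<open>f\<close> so that it applies to both
    \<open>D t0\<close> and \<open>- D t0\<close>, which together bound the absolute value.\<close>
  have half: "f s0 \<le> N / 2 * exp (L * (T - s0))"
    if f: "\<And>s. s \<in> {t0..T} \<Longrightarrow> (f has_real_derivative f' s) (at s within {t0..T})"
      and f': "\<And>s. s \<in> {t0..T} \<Longrightarrow> \<bar>f' s\<bar> \<le> \<bar>D' t0 s\<bar>" and "f T = 0" for f f'
  proof -
    have "N / 2 * exp (L * (T - s0)) - f s0 \<ge> N / 2 * exp (L * (T - T)) - f T"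
    proof (rule has_real_derivative_nonpos_antimono[where f = "\<lambda>s. N / 2 * exp (L * (T - s)) - f s"])
      show "s0 \<le> T" using m by (simp add: Delta_def)
      show "((\<lambda>s. N / 2 * exp (L * (T - s)) - f s) has_real_derivative
          - (2 * K * N * exp (L * (T - s))) - f' s) (at s within {s0..T})" if "s \<in> {s0..T}" for s
      proof -
        have "s \<in> {t0..T}" "{s0..T} \<subseteq> {t0..T}" using m that by (auto simp: Delta_def)
        then have "(f has_real_derivative f' s) (at s within {s0..T})"
          using f DERIV_subset by blast
        then show ?thesis by (auto intro!: derivative_eq_intros simp: L_def)
      qed
      show "- (2 * K * N * exp (L * (T - s))) - f' s \<le> 0" if "s0 < s" "s < T" for s
      proof -
        have s: "(t0, s) \<in> Delta T" "(s, s) \<in> Delta T" "s \<in> {t0..T}" using m that by (auto simp: Delta_def)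
        have "\<bar>f' s\<bar> \<le> K * (\<bar>D t0 s\<bar> + \<bar>D s s\<bar>)" using f'[OF s(3)] D'_le[OF s(1)] by simp
        also have "\<dots> \<le> K * (N * exp (L * (T - s)) + N * exp (L * (T - s)))"
          using K by (intro mult_left_mono add_mono D_le s) auto
        finally show ?thesis by (simp add: algebra_simps)
      qed
    qed
    then show ?thesis using N \<open>f T = 0\<close> by simp
  qed
  have t0: "0 \<le> t0" "t0 \<le> T" using m by (auto simp: Delta_def)
  have der0: "(D t0 has_real_derivative D' t0 s) (at s within {t0..T})" if "s \<in> {t0..T}" for s
    using that t0 by (intro der) (auto simp: Delta_def)
  have DT: "D t0 T = 0" using P' Q' t0 by (simp add: D_def)
  have "D t0 s0 \<le> N / 2 * exp (L * (T - s0))"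
    by (rule half[of "D t0" "D' t0"]) (use der0 DT in auto)
  moreover have "- D t0 s0 \<le> N / 2 * exp (L * (T - s0))"
    by (rule half[of "\<lambda>s. - D t0 s" "\<lambda>s. - D' t0 s"]) (use der0 DT in \<open>auto intro!: DERIV_minus\<close>)
  ultimately have "\<bar>D t0 s0\<bar> \<le> N / 2 * exp (L * (T - s0))" by linarith
  \<comment> \<open>At the maximum point the weighted left side is \<open>N\<close> itself.\<close>
  then have "\<bar>D t0 s0\<bar> * exp (- L * (T - s0)) \<le> N / 2 * exp (L * (T - s0)) * exp (- L * (T - s0))"
    by (rule mult_right_mono) simp
  then have "N \<le> N / 2 * exp (L * (T - s0)) * exp (- L * (T - s0))"
    by (simp add: N_def W_def)
  also have "\<dots> = N / 2" by (simp add: exp_minus)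
  finally have "N \<le> N / 2" .
  then have "N = 0" using N by simp
  then show ?thesis using D_le[OF ts] by (simp add: D_def)
qed

section \<open>Existence through the planar system for the exponential coefficients\<close>

text \<open>
  Clipping \<open>a\<close> to \<open>[0, M/\<lambda>]\<close> and \<open>b\<close> to \<open>[0, M/(1-\<lambda>)]\<close> makes the vector field globally Lipschitz. With
  \<open>M = e\<^bsup>cT\<^esup>\<close> the a priori bounds also hold for the clipped system, whose solution is therefore never
  clipped.
\<close>

lemma diagonal_system_global:
  fixes T c \<kappa> lam \<rho> \<gamma> :: real
  assumes "0 \<le> T" "0 \<le> c" "0 \<le> \<kappa>" "0 \<le> \<rho>" "0 \<le> \<gamma>" "0 < lam" "lam < 1"
  obtains a b p :: "real \<Rightarrow> real" where "a 0 = 1" "b 0 = 1"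
    and "\<And>\<tau>. p \<tau> = lam * a \<tau> + (1 - lam) * b \<tau>"
    and "\<And>\<tau>. \<tau> \<in> {0..T} \<Longrightarrow> 0 \<le> a \<tau> \<and> 0 \<le> b \<tau>"
    and "\<And>\<tau>. \<tau> \<in> {0..T} \<Longrightarrow>
      (a has_real_derivative (c - \<rho> - 2 * \<kappa> * p \<tau>) * a \<tau> + \<kappa> * (p \<tau>)\<^sup>2) (at \<tau> within {0..T})"
    and "\<And>\<tau>. \<tau> \<in> {0..T} \<Longrightarrow>
      (b has_real_derivative (c - \<gamma> - 2 * \<kappa> * p \<tau>) * b \<tau> + \<kappa> * (p \<tau>)\<^sup>2) (at \<tau> within {0..T})"
proof -
  define M where "M = exp (c * T)"
  have M: "0 < M" by (simp add: M_def)
  define A where "A = M / lam"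
  define B where "B = M / (1 - lam)"
  have AB: "0 < A" "0 < B" using M assms by (auto simp: A_def B_def)
  define ca where "ca x = max 0 (min A (fst x))" for x :: "real \<times> real"
  define cb where "cb x = max 0 (min B (snd x))" for x :: "real \<times> real"
  define q where "q x = lam * ca x + (1 - lam) * cb x" for x
  \<comment> \<open>One template serves both components, as \<open>F \<rho> ca\<close> and
    \<open>F \<gamma> cb\<close>. Every occurrence of the unknowns is truncated, and the quadratic
    part is split into products of bounded Lipschitz functions.\<close>
  define F where "F \<delta> u x = (c - \<delta>) * u x + (\<kappa> * (q x * q x) + (- 2 * \<kappa>) * (q x * u x))"
    for \<delta> :: real and u :: "real \<times> real \<Rightarrow> real" and x
  have lip_a: "1-lipschitz_on UNIV ca" and lip_b: "1-lipschitz_on UNIV cb"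
    unfolding ca_def cb_def
    by (intro lipschitz_on_clip lipschitz_onI; simp add: dist_fst_le dist_snd_le)+
  have bd_a: "0 \<le> ca x" "\<bar>ca x\<bar> \<le> A" and bd_b: "0 \<le> cb x" "\<bar>cb x\<bar> \<le> B" for x
    using AB by (auto simp: ca_def cb_def)
  have q0: "0 \<le> q x" for x using bd_a bd_b assms by (simp add: q_def)
  have bd_q: "\<bar>q x\<bar> \<le> 2 * M" for x
  proof -
    have "lam * ca x \<le> lam * A" "(1 - lam) * cb x \<le> (1 - lam) * B"
      using bd_a[of x] bd_b[of x] assms by (auto intro!: mult_left_mono)
    then show ?thesis using q0[of x] assms by (simp add: q_def A_def B_def)
  qed
  obtain Kq where lip_q: "Kq-lipschitz_on UNIV q"
    using lipschitz_on_add[OF lipschitz_on_cmult_real[OF lip_a, of lam] lipschitz_on_cmult_real[OF lip_b, of "1 - lam"]]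
    by (auto simp: q_def[abs_def])
  have lip_F: "\<exists>K. K-lipschitz_on UNIV (F \<delta> u)"
    if "1-lipschitz_on UNIV u" "\<And>x. \<bar>u x\<bar> \<le> U" "0 \<le> U" for \<delta> u U
  proof -
    have "\<exists>K. K-lipschitz_on UNIV (\<lambda>x. q x * u x)"
      using lipschitz_on_mult_bounded[OF lip_q that(1), of "2 * M" U] bd_q that M by auto
    then obtain K1 where K1: "K1-lipschitz_on UNIV (\<lambda>x. q x * u x)" ..
    have "\<exists>K. K-lipschitz_on UNIV (\<lambda>x. q x * q x)"
      using lipschitz_on_mult_bounded[OF lip_q lip_q, of "2 * M" "2 * M"] bd_q M by auto
    then obtain K2 where K2: "K2-lipschitz_on UNIV (\<lambda>x. q x * q x)" ..
    show ?thesis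
      using lipschitz_on_add[OF lipschitz_on_cmult_real[OF that(1), of "c - \<delta>"]
          lipschitz_on_add[OF lipschitz_on_cmult_real[OF K2, of \<kappa>] lipschitz_on_cmult_real[OF K1, of "- 2 * \<kappa>"]]]
      by (auto simp: F_def[abs_def])
  qed
  obtain K1 K2 where "K1-lipschitz_on UNIV (F \<rho> ca)" "K2-lipschitz_on UNIV (F \<gamma> cb)"
    using lip_F[OF lip_a bd_a(2)] lip_F[OF lip_b bd_b(2)] AB by (meson less_imp_le)
  then have "(sqrt (K1\<^sup>2 + K2\<^sup>2))-lipschitz_on UNIV (\<lambda>x. (F \<rho> ca x, F \<gamma> cb x))"
    by (rule lipschitz_on_Pair)
  from picard_global[OF \<open>0 \<le> T\<close> this, of "(1, 1)"] obtain x where x0: "x 0 = (1, 1)"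
    and x: "\<And>\<tau>. \<tau> \<in> {0..T} \<Longrightarrow> (x has_vector_derivative (F \<rho> ca (x \<tau>), F \<gamma> cb (x \<tau>))) (at \<tau> within {0..T})"
    by blast
  define a where "a \<tau> = fst (x \<tau>)" for \<tau>
  define b where "b \<tau> = snd (x \<tau>)" for \<tau>
  define p where "p \<tau> = lam * a \<tau> + (1 - lam) * b \<tau>" for \<tau>
  have da: "(a has_real_derivative F \<rho> ca (x \<tau>)) (at \<tau> within {0..T})"
    and db: "(b has_real_derivative F \<gamma> cb (x \<tau>)) (at \<tau> within {0..T})" if "\<tau> \<in> {0..T}" for \<tau>
    using bounded_linear.has_vector_derivative[OF bounded_linear_fst x[OF that]]
      bounded_linear.has_vector_derivative[OF bounded_linear_snd x[OF that]]
    by (auto simp: a_def[abs_def] b_def[abs_def] has_real_derivative_iff_has_vector_derivative)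
  \<comment> \<open>Where \<open>a\<close> is negative its truncation vanishes, and the field
    reduces to \<open>\<kappa> * q^2\<close>, which is nonnegative.\<close>
  have a_nonneg: "0 \<le> a \<tau>" if "\<tau> \<in> {0..T}" for \<tau>
    by (rule nonneg_if_increasing_below_zero[OF da _ _ that])
      (use x0 AB assms in \<open>auto simp: a_def F_def ca_def\<close>)
  have b_nonneg: "0 \<le> b \<tau>" if "\<tau> \<in> {0..T}" for \<tau>
    by (rule nonneg_if_increasing_below_zero[OF db _ _ that])
      (use x0 AB assms in \<open>auto simp: b_def F_def cb_def\<close>)
  have p_le: "p \<tau> \<le> M" if \<tau>: "\<tau> \<in> {0..T}" for \<tau>
  proof -
    define p' where "p' r = lam * F \<rho> ca (x r) + (1 - lam) * F \<gamma> cb (x r)" for r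
    have p'_le: "p' r \<le> c * p r" if r: "r \<in> {0..T}" for r
    proof -
      \<comment> \<open>The weights sum to 1, so the quadratic terms combine to
        \<open>\<kappa> * q^2 - 2 * \<kappa> * q^2\<close>: the net contribution is a damping
        term.\<close>
      have "p' r = c * q (x r) - (lam * \<rho> * ca (x r) + (1 - lam) * \<gamma> * cb (x r)) - \<kappa> * (q (x r) * q (x r))"
        by (simp add: p'_def F_def q_def algebra_simps)
      also have "\<dots> \<le> c * q (x r)"
      proof -
        have "0 \<le> lam * \<rho> * ca (x r)" "0 \<le> (1 - lam) * \<gamma> * cb (x r)" "0 \<le> \<kappa> * (q (x r) * q (x r))"
          using bd_a(1)[of "x r"] bd_b(1)[of "x r"] assms by auto
        then show ?thesis by linarith
      qed
      \<comment> \<open>Truncating the nonnegative \<open>a\<close> and \<open>b\<close> can only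
        lower them, so \<open>q\<close> is at most \<open>p\<close>.\<close>
      also have "\<dots> \<le> c * p r"
        using a_nonneg[OF r] b_nonneg[OF r] assms
        by (intro mult_left_mono) (auto simp: q_def p_def a_def b_def ca_def cb_def intro!: add_mono mult_left_mono)
      finally show ?thesis .
    qed
    \<comment> \<open>Gronwall argument with integrating factor; \<open>p 0 = 1\<close> since the
      weights sum to 1.\<close>
    have "exp (- c * \<tau>) * p \<tau> \<le> exp (- c * 0) * p 0"
    proof (rule has_real_derivative_nonpos_antimono[where f = "\<lambda>r. exp (- c * r) * p r"])
      show "0 \<le> \<tau>" using \<tau> by simp
      show "((\<lambda>r. exp (- c * r) * p r) has_real_derivative exp (- c * r) * (p' r - c * p r)) (at r within {0..\<tau>})"
        if "r \<in> {0..\<tau>}" for r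
      proof -
        have r: "r \<in> {0..T}" "{0..\<tau>} \<subseteq> {0..T}" using that \<tau> by auto
        have "(p has_real_derivative p' r) (at r within {0..\<tau>})"
          unfolding p_def[abs_def] p'_def
          by (auto intro!: derivative_eq_intros DERIV_subset[OF da[OF r(1)] r(2)] DERIV_subset[OF db[OF r(1)] r(2)])
        then show ?thesis by (auto intro!: derivative_eq_intros simp: algebra_simps)
      qed
      show "exp (- c * r) * (p' r - c * p r) \<le> 0" if "0 < r" "r < \<tau>" for r
        using p'_le[of r] that \<tau> by (simp add: mult_nonneg_nonpos)
    qed
    then have "p \<tau> \<le> exp (c * \<tau>)" by (simp add: p_def a_def b_def x0 exp_minus field_simps)
    also have "\<dots> \<le> M" unfolding M_def using \<tau> assms by (simp add: mult_left_mono)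
    finally show ?thesis .
  qed
  have clip: "ca (x \<tau>) = a \<tau>" "cb (x \<tau>) = b \<tau>" if \<tau>: "\<tau> \<in> {0..T}" for \<tau>
  proof -
    \<comment> \<open>Each summand of \<open>p\<close> is at most \<open>p\<close>, the other being
      nonnegative; dividing by the weight gives exactly the truncation levels \<open>A\<close> and
      \<open>B\<close>.\<close>
    have "lam * a \<tau> \<le> M" "(1 - lam) * b \<tau> \<le> M"
      using p_le[OF \<tau>] mult_nonneg_nonneg[OF _ a_nonneg[OF \<tau>], of lam]
        mult_nonneg_nonneg[OF _ b_nonneg[OF \<tau>], of "1 - lam"] assms by (auto simp: p_def)
    then have "a \<tau> \<le> A" "b \<tau> \<le> B" using assms by (auto simp: A_def B_def field_simps)
    then show "ca (x \<tau>) = a \<tau>" "cb (x \<tau>) = b \<tau>"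
      using a_nonneg[OF \<tau>] b_nonneg[OF \<tau>] by (auto simp: ca_def cb_def a_def b_def)
  qed
  have q_eq: "q (x \<tau>) = p \<tau>" if "\<tau> \<in> {0..T}" for \<tau>
    by (simp add: q_def p_def clip[OF that])
  show thesis
  proof
    show "a 0 = 1" "b 0 = 1" by (auto simp: a_def b_def x0)
    show "p \<tau> = lam * a \<tau> + (1 - lam) * b \<tau>" for \<tau> by (rule p_def)
    fix \<tau> assume \<tau>: "\<tau> \<in> {0..T}"
    show "0 \<le> a \<tau> \<and> 0 \<le> b \<tau>" using a_nonneg b_nonneg \<tau> by blast
    have "F \<rho> ca (x \<tau>) = (c - \<rho> - 2 * \<kappa> * p \<tau>) * a \<tau> + \<kappa> * (p \<tau>)\<^sup>2"
      by (simp add: F_def clip[OF \<tau>] q_eq[OF \<tau>] algebra_simps power2_eq_square)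
    then show "(a has_real_derivative (c - \<rho> - 2 * \<kappa> * p \<tau>) * a \<tau> + \<kappa> * (p \<tau>)\<^sup>2) (at \<tau> within {0..T})"
      using da[OF \<tau>] by simp
    have "F \<gamma> cb (x \<tau>) = (c - \<gamma> - 2 * \<kappa> * p \<tau>) * b \<tau> + \<kappa> * (p \<tau>)\<^sup>2"
      by (simp add: F_def clip[OF \<tau>] q_eq[OF \<tau>] algebra_simps power2_eq_square)
    then show "(b has_real_derivative (c - \<gamma> - 2 * \<kappa> * p \<tau>) * b \<tau> + \<kappa> * (p \<tau>)\<^sup>2) (at \<tau> within {0..T})"
      using db[OF \<tau>] by simp
  qed
qed

text \<open>The reversed time \<open>T - s\<close> turns the terminal condition into the initial
  values 1 of the planar system, taken with \<open>c = \<sigma>\<^sup>2\<close>. The sign of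
  \<open>P\<close> is inherited from \<open>a\<close> and \<open>b\<close>.\<close>

lemma riccati_solution_exists:
  assumes "0 \<le> T" "0 < R" "R \<le> 1" "0 \<le> \<rho>" "0 \<le> \<gamma>" "0 < lam" "lam < 1"
  obtains P where "riccati_solution T \<sigma> R (discount lam \<rho> \<gamma>) P"
    and "\<And>t s. (t, s) \<in> Delta T \<Longrightarrow> 0 \<le> P t s"
proof -
  define \<kappa> where "\<kappa> = 1 / R - 1"
  have "0 \<le> \<kappa>" using assms by (simp add: \<kappa>_def)
  from diagonal_system_global[OF \<open>0 \<le> T\<close> zero_le_power2[of \<sigma>] this \<open>0 \<le> \<rho>\<close> \<open>0 \<le> \<gamma>\<close> \<open>0 < lam\<close> \<open>lam < 1\<close>]
  obtain a b p :: "real \<Rightarrow> real" where ab0: "a 0 = 1" "b 0 = 1"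
    and p: "\<And>\<tau>. p \<tau> = lam * a \<tau> + (1 - lam) * b \<tau>"
    and nonneg: "\<And>\<tau>. \<tau> \<in> {0..T} \<Longrightarrow> 0 \<le> a \<tau> \<and> 0 \<le> b \<tau>"
    and da: "\<And>\<tau>. \<tau> \<in> {0..T} \<Longrightarrow>
      (a has_real_derivative (\<sigma>\<^sup>2 - \<rho> - 2 * \<kappa> * p \<tau>) * a \<tau> + \<kappa> * (p \<tau>)\<^sup>2) (at \<tau> within {0..T})"
    and db: "\<And>\<tau>. \<tau> \<in> {0..T} \<Longrightarrow>
      (b has_real_derivative (\<sigma>\<^sup>2 - \<gamma> - 2 * \<kappa> * p \<tau>) * b \<tau> + \<kappa> * (p \<tau>)\<^sup>2) (at \<tau> within {0..T})"
    by metis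
  define P where "P t s = lam * exp (- \<rho> * (s - t)) * a (T - s) + (1 - lam) * exp (- \<gamma> * (s - t)) * b (T - s)" for t s
  \<comment> \<open>The exponentials equal 1 at \<open>t = s\<close>, so the non-local term is the
    \<open>p\<close> of the planar system and the ansatz closes.\<close>
  have diag: "P s s = p (T - s)" for s by (simp add: P_def p)
  have reflect: "((\<lambda>s. u (T - s)) has_real_derivative - u' (T - s)) (at s within {t..T})"
    if "\<And>\<tau>. \<tau> \<in> {0..T} \<Longrightarrow> (u has_real_derivative u' \<tau>) (at \<tau> within {0..T})" and "(t, s) \<in> Delta T" for u u' t s
  proof -
    have "T - s \<in> {0..T}" "(\<lambda>s. T - s) ` {t..T} \<subseteq> {0..T}" using that(2) by (auto simp: Delta_def)
    then have "(u has_real_derivative u' (T - s)) (at (T - s) within (\<lambda>s. T - s) ` {t..T})"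
      using that(1) DERIV_subset by blast
    moreover have "((\<lambda>s. T - s) has_real_derivative - 1) (at s within {t..T})"
      by (auto intro!: derivative_eq_intros)
    ultimately show ?thesis using DERIV_image_chain by (fastforce simp: o_def)
  qed
  have cont: "continuous_on (Delta T) (\<lambda>x. u (T - snd x))"
    if "\<And>\<tau>. \<tau> \<in> {0..T} \<Longrightarrow> (u has_real_derivative u' \<tau>) (at \<tau> within {0..T})" for u u'
  proof -
    have "continuous_on {0..T} u"
      using that by (meson DERIV_continuous continuous_on_eq_continuous_within)
    then show ?thesis
      by (rule continuous_on_compose2) (auto intro!: continuous_intros simp: Delta_def)
  qed
  show thesis
  proof (rule that[of P])
    show "riccati_solution T \<sigma> R (discount lam \<rho> \<gamma>) P"
      unfolding riccati_solution_iff[OF less_imp_neq[OF \<open>0 < R\<close>, symmetric]] \<kappa>_def[symmetric]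
    proof (intro conjI ballI)
      show "continuous_on (Delta T) (\<lambda>(t, s). P t s)"
        unfolding P_def case_prod_unfold by (intro continuous_intros cont[OF da] cont[OF db])
      show "case x of (t, s) \<Rightarrow> (P t has_real_derivative
          (2 * \<kappa> * P s s - \<sigma>\<^sup>2) * P t s - \<kappa> * discount lam \<rho> \<gamma> (s - t) * (P s s)\<^sup>2) (at s within {t..T})"
        if "x \<in> Delta T" for x
      proof -
        obtain t s where x: "x = (t, s)" by (cases x)
        have ts: "(t, s) \<in> Delta T" using that x by simp
        have "((\<lambda>s. c * exp (- \<delta> * (s - t))) has_real_derivative - \<delta> * (c * exp (- \<delta> * (s - t)))) (at s within {t..T})"
          for c \<delta> :: real by (auto intro!: derivative_eq_intros)
        note dA = DERIV_mult'[OF this reflect[OF da ts], of lam \<rho>]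
          and dB = DERIV_mult'[OF this reflect[OF db ts], of "1 - lam" \<gamma>]
        \<comment> \<open>The rates \<open>\<rho>\<close> and \<open>\<gamma>\<close> from
          differentiating the exponentials cancel those in the equations for \<open>a\<close> and
          \<open>b\<close>; the \<open>\<kappa> * p^2\<close> terms collect the two exponentials
          into \<open>discount\<close>.\<close>
        have "(P t has_real_derivative
          (2 * \<kappa> * P s s - \<sigma>\<^sup>2) * P t s - \<kappa> * discount lam \<rho> \<gamma> (s - t) * (P s s)\<^sup>2) (at s within {t..T})"
          unfolding diag unfolding P_def[abs_def]
          by (rule DERIV_cong[OF DERIV_add[OF dA dB]]) (auto simp: discount_def algebra_simps)
        then show ?thesis using x by simp
      qed
      show "P t T = discount lam \<rho> \<gamma> (T - t)" for t by (simp add: P_def ab0 discount_def)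
    qed
    show "0 \<le> P t s" if "(t, s) \<in> Delta T" for t s
      using nonneg[of "T - s"] that assms by (auto simp: P_def Delta_def)
  qed
qed

section \<open>The explicit case \<open>R = 1\<close> and the conclusion\<close>

text \<open>For \<open>R = 1\<close> the factor \<open>1 / R - 1\<close> vanishes, which removes the
  non-local terms and leaves the linear equation \<open>Ps = - \<sigma>\<^sup>2 * P\<close>.\<close>

lemma riccati_solution_explicit:
  assumes "continuous_on UNIV \<alpha>"
  shows "riccati_solution T \<sigma> 1 \<alpha> (\<lambda>t s. exp (- \<sigma>\<^sup>2 * (s - T)) * \<alpha> (T - t))"
proof -
  have "continuous_on (Delta T) (\<lambda>(t, s). exp (- \<sigma>\<^sup>2 * (s - T)) * \<alpha> (T - t))"
    unfolding case_prod_unfold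
    by (intro continuous_intros continuous_on_compose2[OF assms]) auto
  moreover have "((\<lambda>s. exp (- \<sigma>\<^sup>2 * (s - T)) * \<alpha> (T - t)) has_real_derivative
      - \<sigma>\<^sup>2 * (exp (- \<sigma>\<^sup>2 * (s - T)) * \<alpha> (T - t))) (at s within {t..T})" for t s
    by (auto intro!: derivative_eq_intros)
  ultimately show ?thesis by (simp add: riccati_solution_iff)
qed

theorem theorem2:
  fixes T \<sigma> R lam \<rho> \<gamma> :: real and \<alpha> :: "real \<Rightarrow> real"
  assumes "T > 0" and "0 < R" and "R \<le> 1"
    and "0 < \<rho>" and "\<rho> < \<gamma>" and "0 < lam" and "lam < 1"
    and "\<alpha> = discount lam \<rho> \<gamma>"
  shows "\<exists>P. riccati_solution T \<sigma> R \<alpha> P \<and>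
           (\<forall>Q. riccati_solution T \<sigma> R \<alpha> Q \<longrightarrow> (\<forall>(t, s) \<in> Delta T. Q t s = P t s)) \<and>
           (\<forall>(t, s) \<in> Delta T. P t s \<ge> 0) \<and>
           (R = 1 \<longrightarrow> (\<forall>(t, s) \<in> Delta T. P t s = exp (- \<sigma>\<^sup>2 * (s - T)) * \<alpha> (T - t)))"
proof -
  have cont: "continuous_on S \<alpha>" for S
    unfolding assms(8) discount_def by (intro continuous_intros)
  obtain P where P: "riccati_solution T \<sigma> R \<alpha> P" and nonneg: "\<And>t s. (t, s) \<in> Delta T \<Longrightarrow> 0 \<le> P t s"
    using riccati_solution_exists[of T R \<rho> \<gamma> lam \<sigma>] assms by auto
  have unique: "Q t s = P t s" if "riccati_solution T \<sigma> R \<alpha> Q" "(t, s) \<in> Delta T" for Q t s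
    using riccati_solution_unique[OF _ _ cont that(1) P that(2)] assms by simp
  \<comment> \<open>The closed formula is itself a solution, so uniqueness identifies it with
    \<open>P\<close> on the triangle.\<close>
  have explicit: "P t s = exp (- \<sigma>\<^sup>2 * (s - T)) * \<alpha> (T - t)" if "R = 1" "(t, s) \<in> Delta T" for t s
    using unique[OF _ that(2), of "\<lambda>t s. exp (- \<sigma>\<^sup>2 * (s - T)) * \<alpha> (T - t)"]
      riccati_solution_explicit[OF cont] that(1) by simp
  show ?thesis
    by (intro exI[of _ P] conjI impI allI ballI P; clarify; rule unique nonneg explicit)
qed

end
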